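(* Let $b>0$, let $f:\mathbb{R}\to\mathbb{R}$ be a periodic function with period $2b$, let $N=2M$ be an even positive integer, and set $x_j=-b+\frac{2b}{N}j$ and $y_j=f(x_j)$ for $0\le j<N$. (1) Suppose $f$ is even. Then there is a unique trigonometric polynomial of the form $f_M(x)=\sum_{0\le j<M}a_j\cos\frac{j\pi x}{b}$ such that for all $0\le k<M$ $$f_M(x_{2k})=y_{2k},\qquad f_M(x_{2k+1})=y_{2k+1}+\epsilon_M,\qquad\text{where }\ \epsilon_M=\frac1M\sum_{0\le j<N}(-1)^jy_j .$$ Its coefficients are $$a_0=\frac1M\sum_{0\le j<M}y_{2j},\qquad a_j=\frac2N\sum_{0\le k<N}(-1)^jy_k\cos\frac{2\pi jk}{N}\quad(1\le j<M).$$ (2) Suppose $f$ is odd. Then there is a unique trigonometric polynomial of the form $f_M(x)=\sum_{0\le j<M}a_j\sin\frac{j\pi x}{b}$ such that $f_M(x_k)=y_k$ for all $0\le k<N$. It is given by the coefficients $$a_j=\frac2N\sum_{0\le k<N}(-1)^jy_k\sin\frac{2\pi jk}{N}\quad(0\le j<M).$$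
   Context: In part (2) the $j=0$ term of the sine sum vanishes identically, so uniqueness refers to $f_M$ as a function (equivalently, to the coefficients $a_j$ with $1\le j<M$). *)

theory Defs
  imports Complex_Main
begin

text \<open>Only the coefficients \<open>a j\<close> with \<open>j < M\<close> matter; values of \<open>a\<close> beyond that are junk.\<close>

definition cos_poly :: "real \<Rightarrow> nat \<Rightarrow> (nat \<Rightarrow> real) \<Rightarrow> real \<Rightarrow> real" where
  "cos_poly b M a = (\<lambda>t. \<Sum>j<M. a j * cos (real j * pi * t / b))"

definition sin_poly :: "real \<Rightarrow> nat \<Rightarrow> (nat \<Rightarrow> real) \<Rightarrow> real \<Rightarrow> real" where
  "sin_poly b M a = (\<lambda>t. \<Sum>j<M. a j * sin (real j * pi * t / b))"

end

theory Submission
  imports Defs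
begin

text \<open>
  At the nodes, \<open>j \<pi> x\<^sub>k / b = 2 \<pi> j k / N - j \<pi>\<close>, so up to the signs \<open>(-1)\<^sup>j\<close> the two
  interpolation problems are a discrete cosine and a discrete sine transform of length \<open>N\<close>, whose
  inversion is the orthogonality of the characters of \<open>\<int>/N\<close>. An even sequence on \<open>\<int>/2M\<close> is a
  combination of \<open>cos (2 \<pi> j k / N)\<close> with \<open>j \<le> M\<close>; the summand \<open>j = M\<close> is
  \<open>(-1)\<^sup>k\<close>, and \<open>\<epsilon>\<^sub>M\<close> is exactly the shift of the odd nodes that makes its coefficient vanish.
\<close>

section \<open>Orthogonality of cosines and sines over a full period of length
  \<open>N\<close>\<close>

lemma sum_cos_period:
  fixes n :: int
  assumes "N > 0"
  shows "(\<Sum>k<N. cos (2 * pi * real_of_int n * real k / real N)) = (if int N dvd n then real N else 0)"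
proof (cases "int N dvd n")
  case True
  then obtain m where m: "n = int N * m" by (elim dvdE)
  have "cos (2 * pi * real_of_int n * real k / real N) = 1" for k
    using assms cos_int_2pin[of "m * int k"] by (simp add: m mult.assoc)
  with True show ?thesis by simp
next
  case False
  \<comment> \<open>The sum is the real part of a geometric series in the \<open>N\<close>-th root
    of unity \<open>w\<close>, which differs from 1 exactly because \<open>N\<close> does not divide
    \<open>n\<close>.\<close>
  define w where "w = cis (2 * pi * real_of_int n / real N)"
  have pow: "w ^ k = cis (2 * pi * real_of_int n * real k / real N)" for k
    unfolding w_def DeMoivre by (simp add: mult_ac)
  have "w \<noteq> 1"
  proof
    assume "w = 1"
    hence "cos (2 * pi * real_of_int n / real N) = 1" by (simp add: w_def complex_eq_iff)
    then obtain m :: int where "2 * pi * real_of_int n / real N = real_of_int m * 2 * pi"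
      using cos_one_2pi_int by auto
    hence "real_of_int n = real_of_int (m * int N)" using assms by (simp add: field_simps)
    hence "n = m * int N" by linarith
    with False show False by simp
  qed
  moreover have "w ^ N = 1"
    using assms cis_multiple_2pi[of "real_of_int n"] by (simp add: pow)
  ultimately have "(\<Sum>k<N. w ^ k) = 0" by (simp add: geometric_sum)
  hence "Re (\<Sum>k<N. w ^ k) = 0" by simp
  with False show ?thesis by (simp add: pow)
qed

text \<open>Product-to-sum formulas reduce this to character sums at the frequencies
  \<open>i - j\<close> and \<open>i + j\<close>; the first may be negative, hence the passage to
  \<open>int\<close>. Both conditions can hold at once, as for \<open>i = j = 0\<close>, and then
  the halves add up to \<open>N\<close>.\<close>

lemma sum_cos_cos:
  fixes i j :: nat
  assumes "N > 0"
  shows "(\<Sum>k<N. cos (2 * pi * real i * real k / real N) * cos (2 * pi * real j * real k / real N)) =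
    (if int N dvd int i - int j then real N / 2 else 0) + (if N dvd i + j then real N / 2 else 0)"
proof -
  have "(\<Sum>k<N. cos (2 * pi * real i * real k / real N) * cos (2 * pi * real j * real k / real N)) =
    ((\<Sum>k<N. cos (2 * pi * real_of_int (int i - int j) * real k / real N)) +
     (\<Sum>k<N. cos (2 * pi * real_of_int (int i + int j) * real k / real N))) / 2"
    unfolding sum.distrib[symmetric] sum_divide_distrib
    by (intro sum.cong) (auto simp: cos_times_cos ring_distribs diff_divide_distrib add_divide_distrib)
  also have "\<dots> = (if int N dvd int i - int j then real N / 2 else 0) + (if N dvd i + j then real N / 2 else 0)"
    unfolding sum_cos_period[OF assms] of_nat_add[symmetric] int_dvd_int_iff by simp
  finally show ?thesis .
qed

text \<open>The same reduction as for cosines, but the term at \<open>i + j\<close> enters with a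
  minus sign, so the halves cancel when both conditions hold.\<close>

lemma sum_sin_sin:
  fixes i j :: nat
  assumes "N > 0"
  shows "(\<Sum>k<N. sin (2 * pi * real i * real k / real N) * sin (2 * pi * real j * real k / real N)) =
    (if int N dvd int i - int j then real N / 2 else 0) - (if N dvd i + j then real N / 2 else 0)"
proof -
  have "(\<Sum>k<N. sin (2 * pi * real i * real k / real N) * sin (2 * pi * real j * real k / real N)) =
    ((\<Sum>k<N. cos (2 * pi * real_of_int (int i - int j) * real k / real N)) -
     (\<Sum>k<N. cos (2 * pi * real_of_int (int i + int j) * real k / real N))) / 2"
    unfolding sum_subtractf[symmetric] sum_divide_distrib
    by (intro sum.cong) (auto simp: sin_times_sin ring_distribs diff_divide_distrib add_divide_distrib)
  also have "\<dots> = (if int N dvd int i - int j then real N / 2 else 0) - (if N dvd i + j then real N / 2 else 0)"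
    unfolding sum_cos_period[OF assms] of_nat_add[symmetric] int_dvd_int_iff by simp
  finally show ?thesis .
qed

lemma dvd_diff_less_iff:
  fixes i j :: nat
  assumes "i < N" "j < N"
  shows "int N dvd int i - int j \<longleftrightarrow> i = j"
  using assms dvd_imp_le_int[of "int i - int j" "int N"] by (cases "i = j") auto

text \<open>Since \<open>i + j < 2 * N\<close>, the only possible multiples are 0 and
  \<open>N\<close>. The conditional names the representative of \<open>-j\<close> modulo
  \<open>N\<close> in the range below \<open>N\<close>.\<close>

lemma dvd_add_less_iff:
  fixes i j :: nat
  assumes "i < N" "j < N"
  shows "N dvd i + j \<longleftrightarrow> i = (if j = 0 then 0 else N - j)"
proof
  assume "N dvd i + j"
  then obtain m where m: "i + j = N * m" by (elim dvdE)
  with assms have "N * m < N * 2" by linarith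
  hence "m < 2" by simp
  hence "m = 0 \<or> m = 1" by auto
  with m assms show "i = (if j = 0 then 0 else N - j)" by auto
qed (use assms in \<open>auto split: if_splits\<close>)

section \<open>Reflection symmetry and inversion of the discrete cosine and sine transforms\<close>

lemma sum_reflect:
  fixes h :: "nat \<Rightarrow> real"
  assumes "M > 0" and "\<And>j. 0 < j \<Longrightarrow> j < M \<Longrightarrow> h (2 * M - j) = h j"
  shows "(\<Sum>j<2*M. h j) = h M + (\<Sum>j<M. (if j = 0 then 1 else 2) * h j)"
proof -
  have "(\<Sum>j<2*M. h j) = h 0 + (\<Sum>j\<in>{1..<M}. h j) + (h M + (\<Sum>j\<in>{M+1..<2*M}. h j))"
  proof -
    have "{..<2*M} = insert 0 {1..<M} \<union> insert M {M+1..<2*M}" using assms(1) by auto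
    thus ?thesis using assms(1) by (simp add: sum.union_disjoint)
  qed
  \<comment> \<open>The involution sending \<open>j\<close> to \<open>2 * M - j\<close> exchanges
    the two open halves. Its fixed points modulo \<open>2 * M\<close> are 0 and \<open>M\<close>,
    which is why \<open>h 0\<close> gets weight 1 and \<open>h M\<close> stands alone.\<close>
  also have "(\<Sum>j\<in>{M+1..<2*M}. h j) = (\<Sum>j\<in>{1..<M}. h j)"
    by (rule sum.reindex_bij_witness[where i="\<lambda>j. 2*M - j" and j="\<lambda>j. 2*M - j"])
       (auto simp: assms(2)[symmetric])
  also have "h 0 + (\<Sum>j\<in>{1..<M}. h j) + (h M + (\<Sum>j\<in>{1..<M}. h j)) =
      h M + (\<Sum>j\<in>insert 0 {1..<M}. (if j = 0 then 1 else 2) * h j)"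
    by (simp add: sum_distrib_left[symmetric])
  also have "insert 0 {1..<M} = {..<M}" using assms(1) by auto
  finally show ?thesis .
qed

lemma cos_reflect:
  assumes "N > 0" "j \<le> N"
  shows "cos (2 * pi * real (N - j) * real k / real N) = cos (2 * pi * real j * real k / real N)"
proof -
  have "2 * pi * real (N - j) * real k / real N = 2 * pi * real k - 2 * pi * real j * real k / real N"
    using assms by (simp add: of_nat_diff field_simps)
  thus ?thesis using sin_2npi[of k] cos_2npi[of k] by (simp add: cos_diff mult_ac)
qed

lemma sin_reflect:
  assumes "N > 0" "j \<le> N"
  shows "sin (2 * pi * real (N - j) * real k / real N) = - sin (2 * pi * real j * real k / real N)"
proof -
  have "2 * pi * real (N - j) * real k / real N = 2 * pi * real k - 2 * pi * real j * real k / real N"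
    using assms by (simp add: of_nat_diff field_simps)
  thus ?thesis using sin_2npi[of k] cos_2npi[of k] by (simp add: sin_diff mult_ac)
qed

text \<open>By \<open>reflect\<close>, \<open>z\<close> is a combination of cosines with frequencies
  up to \<open>M\<close>, and \<open>alt\<close> says that its coefficient at \<open>M\<close> is
  zero. Orthogonality over the nodes yields the coefficients; orthogonality over the frequencies
  shows that they interpolate.\<close>

lemma dct_interpolation_iff:
  fixes c z :: "nat \<Rightarrow> real"
  assumes M: "M > 0" and N: "N = 2 * M"
    and reflect: "\<And>k. 0 < k \<Longrightarrow> k < N \<Longrightarrow> z (N - k) = z k"
    and alt: "(\<Sum>k<N. (-1) ^ k * z k) = 0"
  shows "(\<forall>k<N. (\<Sum>j<M. c j * cos (2 * pi * real j * real k / real N)) = z k) \<longleftrightarrow>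
    (\<forall>j<M. c j = (if j = 0 then 1 else 2) / real N * (\<Sum>k<N. z k * cos (2 * pi * real j * real k / real N)))"
    (is "?interp \<longleftrightarrow> ?coeff")
proof
  let ?C = "\<lambda>j k. cos (2 * pi * real j * real k / real N)"
  have N0: "N > 0" using M N by simp
  {
    assume ?interp
    show ?coeff
    proof (intro allI impI)
      fix i assume i: "i < M"
      have "(\<Sum>k<N. z k * ?C i k) = (\<Sum>k<N. \<Sum>j<M. c j * (?C j k * ?C i k))"
        using \<open>?interp\<close> by (intro sum.cong) (auto simp flip: sum_distrib_right mult.assoc)
      also have "\<dots> = (\<Sum>j<M. c j * (\<Sum>k<N. ?C j k * ?C i k))"
        by (subst sum.swap) (simp add: sum_distrib_left)
      \<comment> \<open>As \<open>j + i < N\<close>, the second term of \<open>sum_cos_cos\<close>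
        appears only for \<open>j = i = 0\<close>. This doubles the norm at frequency 0 and explains
        the factor 1 instead of 2 there.\<close>
      also have "\<dots> = (\<Sum>j<M. if j = i then c i * real N / (if i = 0 then 1 else 2) else 0)"
      proof (intro sum.cong refl)
        fix j assume j: "j \<in> {..<M}"
        hence "int N dvd int j - int i \<longleftrightarrow> j = i" "N dvd j + i \<longleftrightarrow> j = i \<and> i = 0"
          using i dvd_diff_less_iff[of j N i] dvd_add_less_iff[of j N i] by (auto simp: N split: if_splits)
        thus "c j * (\<Sum>k<N. ?C j k * ?C i k) = (if j = i then c i * real N / (if i = 0 then 1 else 2) else 0)"
          by (simp add: sum_cos_cos[OF N0])
      qed
      also have "\<dots> = c i * real N / (if i = 0 then 1 else 2)" using i by simp
      finally show "c i = (if i = 0 then 1 else 2) / real N * (\<Sum>k<N. z k * ?C i k)"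
        using N0 by (simp add: field_simps)
    qed
  next
    assume ?coeff
    show ?interp
    proof (intro allI impI)
      fix k assume k: "k < N"
      \<comment> \<open>Up to the weight and the factor \<open>1 / N\<close>, \<open>h j\<close> is
        the contribution of frequency \<open>j\<close> to the inversion formula; unlike
        \<open>c j\<close>, it is meaningful for every \<open>j\<close> up to
        \<open>2 * M\<close>.\<close>
      define h where "h j = (\<Sum>l<N. z l * ?C j l) * ?C j k" for j
      have "h M = 0"
      proof -
        have "2 * pi * real M * real l / real N = real l * pi" for l
          using M N by (simp add: field_simps)
        hence "?C M l = (-1) ^ l" for l by simp
        thus ?thesis using alt by (simp add: h_def mult.commute)
      qed
      have h_reflect: "h (2 * M - j) = h j" if "0 < j" "j < M" for j
      proof -
        have "j \<le> N" using that N by simp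
        thus ?thesis unfolding h_def N[symmetric] by (simp add: cos_reflect[OF N0] del: of_nat_diff)
      qed
      have "(\<Sum>j<M. c j * ?C j k) = (\<Sum>j<M. (if j = 0 then 1 else 2) * h j) / real N"
        unfolding sum_divide_distrib using \<open>?coeff\<close> by (intro sum.cong) (auto simp: h_def)
      \<comment> \<open>Folding is used backwards: orthogonality needs all \<open>N\<close>
        frequencies, and the extra frequency \<open>M\<close> contributes nothing.\<close>
      also have "(\<Sum>j<M. (if j = 0 then 1 else 2) * h j) = (\<Sum>j<2*M. h j)"
        using \<open>h M = 0\<close> h_reflect by (simp add: sum_reflect[OF M])
      \<comment> \<open>The kernel is symmetric in frequency and node, so \<open>sum_cos_cos\<close>
        applies with the two roles exchanged.\<close>
      also have "\<dots> = (\<Sum>l<N. z l * (\<Sum>j<N. ?C l j * ?C k j))"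
        unfolding h_def N[symmetric] sum_distrib_right
        by (subst sum.swap) (simp add: sum_distrib_left mult_ac)
      \<comment> \<open>Half of the value comes from \<open>l = k\<close> and half from its mirror
        image modulo \<open>N\<close>; \<open>reflect\<close> makes the two halves equal.\<close>
      also have "\<dots> = (\<Sum>l<N. (if l = k then z l * real N / 2 else 0) +
          (if l = (if k = 0 then 0 else N - k) then z l * real N / 2 else 0))"
        using k by (intro sum.cong) (auto simp: sum_cos_cos[OF N0] dvd_diff_less_iff dvd_add_less_iff)
      also have "\<dots> = z k * real N"
        using k reflect[of k] unfolding sum.distrib by (cases "k = 0") simp_all
      finally show "(\<Sum>j<M. c j * ?C j k) = z k" using N0 by simp
    qed
  }
qed

text \<open>The odd analogue. The sine of frequency \<open>M\<close> vanishes at every node, so no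
  alternating-sum condition is required, and \<open>c 0\<close> stays free because its sine is zero.
  At \<open>k = 0\<close> the mirror terms cancel instead of adding up, so \<open>z0\<close>
  supplies the value there.\<close>

lemma dst_interpolation_iff:
  fixes c z :: "nat \<Rightarrow> real"
  assumes M: "M > 0" and N: "N = 2 * M"
    and reflect: "\<And>k. 0 < k \<Longrightarrow> k < N \<Longrightarrow> z (N - k) = - z k"
    and z0: "z 0 = 0"
  shows "(\<forall>k<N. (\<Sum>j<M. c j * sin (2 * pi * real j * real k / real N)) = z k) \<longleftrightarrow>
    (\<forall>j. 1 \<le> j \<and> j < M \<longrightarrow> c j = 2 / real N * (\<Sum>k<N. z k * sin (2 * pi * real j * real k / real N)))"
    (is "?interp \<longleftrightarrow> ?coeff")
proof
  let ?S = "\<lambda>j k. sin (2 * pi * real j * real k / real N)"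
  have N0: "N > 0" using M N by simp
  {
    assume ?interp
    show ?coeff
    proof (intro allI impI)
      fix i assume i: "1 \<le> i \<and> i < M"
      have "(\<Sum>k<N. z k * ?S i k) = (\<Sum>k<N. \<Sum>j<M. c j * (?S j k * ?S i k))"
        using \<open>?interp\<close> by (intro sum.cong) (auto simp flip: sum_distrib_right mult.assoc)
      also have "\<dots> = (\<Sum>j<M. c j * (\<Sum>k<N. ?S j k * ?S i k))"
        by (subst sum.swap) (simp add: sum_distrib_left)
      also have "\<dots> = (\<Sum>j<M. if j = i then c i * real N / 2 else 0)"
      proof (intro sum.cong refl)
        fix j assume j: "j \<in> {..<M}"
        hence "int N dvd int j - int i \<longleftrightarrow> j = i" "\<not> N dvd j + i"
          using i dvd_diff_less_iff[of j N i] dvd_add_less_iff[of j N i] by (auto simp: N split: if_splits)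
        thus "c j * (\<Sum>k<N. ?S j k * ?S i k) = (if j = i then c i * real N / 2 else 0)"
          by (simp add: sum_sin_sin[OF N0])
      qed
      also have "\<dots> = c i * real N / 2" using i by simp
      finally show "c i = 2 / real N * (\<Sum>k<N. z k * ?S i k)"
        using N0 by (simp add: field_simps)
    qed
  next
    assume ?coeff
    show ?interp
    proof (intro allI impI)
      fix k assume k: "k < N"
      define h where "h j = (\<Sum>l<N. z l * ?S j l) * ?S j k" for j
      have "h M = 0"
      proof -
        have "2 * pi * real M * real l / real N = real l * pi" for l
          using M N by (simp add: field_simps)
        thus ?thesis by (simp add: h_def)
      qed
      have h_reflect: "h (2 * M - j) = h j" if "0 < j" "j < M" for j
      proof -
        have "j \<le> N" using that N by simp
        thus ?thesis unfolding h_def N[symmetric] by (simp add: sin_reflect[OF N0] sum_negf del: of_nat_diff)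
      qed
      have "(\<Sum>j<M. c j * ?S j k) = (\<Sum>j<M. (if j = 0 then 1 else 2) * h j) / real N"
        unfolding sum_divide_distrib using \<open>?coeff\<close> by (intro sum.cong) (auto simp: h_def)
      also have "(\<Sum>j<M. (if j = 0 then 1 else 2) * h j) = (\<Sum>j<2*M. h j)"
        using \<open>h M = 0\<close> h_reflect by (simp add: sum_reflect[OF M])
      also have "\<dots> = (\<Sum>l<N. z l * (\<Sum>j<N. ?S l j * ?S k j))"
        unfolding h_def N[symmetric] sum_distrib_right
        by (subst sum.swap) (simp add: sum_distrib_left mult_ac)
      also have "\<dots> = (\<Sum>l<N. (if l = k then z l * real N / 2 else 0) -
          (if l = (if k = 0 then 0 else N - k) then z l * real N / 2 else 0))"
        using k by (intro sum.cong) (auto simp: sum_sin_sin[OF N0] dvd_diff_less_iff dvd_add_less_iff)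
      also have "\<dots> = z k * real N"
        using k reflect[of k] z0 unfolding sum_subtractf by (cases "k = 0") simp_all
      finally show "(\<Sum>j<M. c j * ?S j k) = z k" using N0 by simp
    qed
  }
qed

section \<open>Splitting the nodes by parity and moving the sign to the data\<close>

lemma all_less_double_iff:
  fixes M :: nat
  shows "(\<forall>k<2*M. P k) \<longleftrightarrow> (\<forall>k<M. P (2 * k) \<and> P (2 * k + 1))"
proof
  assume *: "\<forall>k<M. P (2 * k) \<and> P (2 * k + 1)"
  show "\<forall>k<2*M. P k"
  proof (intro allI impI)
    fix k assume "k < 2 * M"
    thus "P k" using * by (cases "even k") (auto elim!: evenE oddE)
  qed
qed auto

lemma sum_double:
  fixes g :: "nat \<Rightarrow> 'a :: comm_monoid_add"
  shows "(\<Sum>k<2*M. g k) = (\<Sum>k<M. g (2 * k)) + (\<Sum>k<M. g (2 * k + 1))"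
  by (induction M) (simp_all add: algebra_simps)

text \<open>The sign is its own inverse. This turns formulas for the coefficients
  \<open>(-1) ^ j * a j\<close> of the transforms into formulas for \<open>a j\<close>.\<close>

lemma neg_one_power_mult_eq_sum_iff:
  fixes u K :: real
  shows "(-1) ^ n * u = K * (\<Sum>k\<in>A. g k * h k) \<longleftrightarrow> u = K * (\<Sum>k\<in>A. (-1) ^ n * g k * h k)"
proof -
  have "(\<Sum>k\<in>A. (-1) ^ n * g k * h k) = (-1) ^ n * (\<Sum>k\<in>A. g k * h k)"
    by (simp only: sum_distrib_left mult.assoc)
  thus ?thesis by (cases "even n") auto
qed

text \<open>Uniqueness is stated for the function \<open>F\<close>, since values of \<open>a\<close>
  from index \<open>M\<close> on do not affect it. The cosine coefficients are characterized by an
  equivalence; the sine part is split into two implications because \<open>a 0\<close> is arbitrary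
  for an interpolating sine sum.\<close>

theorem theorem2p1:
  fixes b eps :: real and f :: "real \<Rightarrow> real" and M N :: nat and x y :: "nat \<Rightarrow> real"
  assumes "b > 0"
    and "\<forall>t. f (t + 2 * b) = f t"
    and "N = 2 * M" and "N > 0"
    and "\<forall>j<N. x j = - b + 2 * b / real N * real j"
    and "\<forall>j<N. y j = f (x j)"
    and "eps = 1 / real M * (\<Sum>j<N. (-1) ^ j * y j)"
  shows
    "((\<forall>t. f (- t) = f t) \<longrightarrow>
        (\<exists>!F. (\<exists>a. F = cos_poly b M a) \<and>
           (\<forall>k<M. F (x (2 * k)) = y (2 * k) \<and> F (x (2 * k + 1)) = y (2 * k + 1) + eps)) \<and>
        (\<forall>a. (\<forall>k<M. cos_poly b M a (x (2 * k)) = y (2 * k) \<and>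
                cos_poly b M a (x (2 * k + 1)) = y (2 * k + 1) + eps) \<longleftrightarrow>
           a 0 = 1 / real M * (\<Sum>j<M. y (2 * j)) \<and>
           (\<forall>j. 1 \<le> j \<and> j < M \<longrightarrow>
              a j = 2 / real N * (\<Sum>k<N. (-1) ^ j * y k * cos (2 * pi * real j * real k / real N))))) \<and>
     ((\<forall>t. f (- t) = - f t) \<longrightarrow>
        (\<exists>!F. (\<exists>a. F = sin_poly b M a) \<and> (\<forall>k<N. F (x k) = y k)) \<and>
        (\<forall>a. (\<forall>j<M. a j = 2 / real N * (\<Sum>k<N. (-1) ^ j * y k * sin (2 * pi * real j * real k / real N)))
           \<longrightarrow> (\<forall>k<N. sin_poly b M a (x k) = y k)) \<and>
        (\<forall>a. (\<forall>k<N. sin_poly b M a (x k) = y k) \<longrightarrow>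
           (\<forall>j. 1 \<le> j \<and> j < M \<longrightarrow>
              a j = 2 / real N * (\<Sum>k<N. (-1) ^ j * y k * sin (2 * pi * real j * real k / real N)))))"
proof -
  note b = assms(1) and per = assms(2) and N = assms(3) and N0 = assms(4)
    and eps = assms(7)
  have M: "M > 0" using N N0 by simp
  have x: "x k = - b + 2 * b / real N * real k" if "k < N" for k using assms(5) that by blast
  have y: "y k = f (x k)" if "k < N" for k using assms(6) that by blast
  \<comment> \<open>The left end \<open>-b\<close> of the grid causes the shift by
    \<open>j * pi\<close>, which becomes the sign \<open>(-1) ^ j\<close> in the next two
    facts.\<close>
  have angle: "real j * pi * x k / b = 2 * pi * real j * real k / real N - real j * pi" if "k < N" for j k
    using b N0 by (simp add: x[OF that] field_simps)
  have cos_poly_x: "cos_poly b M a (x k) = (\<Sum>j<M. ((-1) ^ j * a j) * cos (2 * pi * real j * real k / real N))"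
    if "k < N" for a k
    unfolding cos_poly_def angle[OF that] by (simp add: cos_diff mult_ac)
  have sin_poly_x: "sin_poly b M a (x k) = (\<Sum>j<M. ((-1) ^ j * a j) * sin (2 * pi * real j * real k / real N))"
    if "k < N" for a k
    unfolding sin_poly_def angle[OF that] by (simp add: sin_diff mult_ac)
  have x_reflect: "x (N - k) = - x k" if "0 < k" "k < N" for k
    using that b by (simp add: x of_nat_diff field_simps)

  \<comment> \<open>Even \<open>f\<close>: cosine interpolation of the data with shifted odd
    nodes\<close>
  have even_case: "(\<exists>!F. (\<exists>a. F = cos_poly b M a) \<and>
           (\<forall>k<M. F (x (2 * k)) = y (2 * k) \<and> F (x (2 * k + 1)) = y (2 * k + 1) + eps)) \<and>
        (\<forall>a. (\<forall>k<M. cos_poly b M a (x (2 * k)) = y (2 * k) \<and>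
                cos_poly b M a (x (2 * k + 1)) = y (2 * k + 1) + eps) \<longleftrightarrow>
           a 0 = 1 / real M * (\<Sum>j<M. y (2 * j)) \<and>
           (\<forall>j. 1 \<le> j \<and> j < M \<longrightarrow>
              a j = 2 / real N * (\<Sum>k<N. (-1) ^ j * y k * cos (2 * pi * real j * real k / real N))))"
    (is "?unique \<and> (\<forall>a. ?interp (cos_poly b M a) \<longleftrightarrow> ?coeff a)")
    if even: "\<forall>t. f (- t) = f t"
  proof -
    define z where "z k = y k + (if odd k then eps else 0)" for k
    have interp_iff: "?interp F \<longleftrightarrow> (\<forall>k<N. F (x k) = z k)" for F
      unfolding N all_less_double_iff by (simp add: z_def)
    \<comment> \<open>As \<open>N\<close> is even, \<open>k\<close> and \<open>N - k\<close> have
      the same parity, so the shift of the odd nodes respects the reflection.\<close>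
    have z_reflect: "z (N - k) = z k" if "0 < k" "k < N" for k
      using that even x_reflect[OF that] N0 by (simp add: z_def y) (auto simp: N)
    have eps_M: "real M * eps = (\<Sum>j<M. y (2 * j)) - (\<Sum>j<M. y (2 * j + 1))"
      using M by (simp add: eps N sum_double sum_negf)
    \<comment> \<open>Raising the \<open>M\<close> odd-indexed values by \<open>eps\<close> lowers
      the alternating sum by \<open>M * eps\<close>, which is the whole alternating sum of
      \<open>y\<close>.\<close>
    have alt: "(\<Sum>k<N. (-1) ^ k * z k) = 0"
      using eps_M by (simp add: N sum_double z_def sum_negf sum_subtractf)
    \<comment> \<open>The shift makes the odd-indexed values sum to the same total as the
      even-indexed ones, so \<open>a 0\<close> is the mean over the even nodes.\<close>
    have sum_z: "(\<Sum>k<N. z k) = 2 * (\<Sum>j<M. y (2 * j))"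
      using eps_M by (simp add: N sum_double z_def sum.distrib)
    \<comment> \<open>For \<open>1 \<le> j\<close> the shift is invisible to the coefficients: the
      cosines sum to zero over the odd indices alone.\<close>
    have sum_z_cos: "(\<Sum>k<N. z k * cos (2 * pi * real j * real k / real N)) =
        (\<Sum>k<N. y k * cos (2 * pi * real j * real k / real N))" if j: "1 \<le> j" "j < M" for j
    proof -
      let ?C = "\<lambda>k. cos (2 * pi * real j * real k / real N)"
      have "\<not> N dvd j" using j N by (auto dest: dvd_imp_le)
      hence all0: "(\<Sum>k<N. ?C k) = 0"
        using sum_cos_period[OF N0, of "int j"] by (simp add: int_dvd_int_iff)
      have "\<not> M dvd j" using j by (auto dest: dvd_imp_le)
      \<comment> \<open>On even indices the angle is \<open>2 * pi * j * k / M\<close>, giving a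
        full character sum of length \<open>M\<close>.\<close>
      have "(\<Sum>k<M. ?C (2 * k)) = 0"
        using sum_cos_period[OF M, of "int j"] \<open>\<not> M dvd j\<close> by (simp add: N mult_ac)
      hence odd0: "(\<Sum>k<M. ?C (2 * k + 1)) = 0"
        using all0 by (simp only: N sum_double)
      have "(\<Sum>k<N. z k * ?C k) = (\<Sum>k<N. y k * ?C k) + (\<Sum>k<N. (if odd k then eps else 0) * ?C k)"
        by (simp add: z_def distrib_right sum.distrib)
      also have "(\<Sum>k<N. (if odd k then eps else 0) * ?C k) = (\<Sum>k<M. eps * ?C (2 * k + 1))"
        unfolding N sum_double by simp
      also have "\<dots> = 0" by (simp only: sum_distrib_left[symmetric] odd0 mult_zero_right)
      finally show ?thesis by simp
    qed
    have coeff: "?interp (cos_poly b M a) \<longleftrightarrow> ?coeff a" for a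
    proof -
      have "?interp (cos_poly b M a) \<longleftrightarrow>
          (\<forall>k<N. (\<Sum>j<M. ((-1) ^ j * a j) * cos (2 * pi * real j * real k / real N)) = z k)"
        unfolding interp_iff by (simp add: cos_poly_x)
      also have "\<dots> \<longleftrightarrow> (\<forall>j<M. (-1) ^ j * a j =
          (if j = 0 then 1 else 2) / real N * (\<Sum>k<N. z k * cos (2 * pi * real j * real k / real N)))"
        using M N z_reflect alt by (rule dct_interpolation_iff)
      also have "\<dots> \<longleftrightarrow> (\<forall>j<M. a j = (if j = 0 then 1 / real M * (\<Sum>j<M. y (2 * j))
          else 2 / real N * (\<Sum>k<N. (-1) ^ j * y k * cos (2 * pi * real j * real k / real N))))"
      proof (intro all_cong)
        fix j assume j: "j < M"
        show "(-1) ^ j * a j =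
            (if j = 0 then 1 else 2) / real N * (\<Sum>k<N. z k * cos (2 * pi * real j * real k / real N)) \<longleftrightarrow>
          a j = (if j = 0 then 1 / real M * (\<Sum>j<M. y (2 * j))
            else 2 / real N * (\<Sum>k<N. (-1) ^ j * y k * cos (2 * pi * real j * real k / real N)))"
        proof (cases "j = 0")
          case True
          have "1 / real N * (\<Sum>k<N. z k) = 1 / real M * (\<Sum>j<M. y (2 * j))"
            unfolding sum_z using N by simp
          with True show ?thesis by simp
        next
          case False
          with j have "1 \<le> j" by simp
          with False show ?thesis
            by (simp only: sum_z_cos[OF _ j] neg_one_power_mult_eq_sum_iff if_False)
        qed
      qed
      also have "\<dots> \<longleftrightarrow> ?coeff a"
        using M by (auto simp: Suc_le_eq)
      finally show ?thesis .
    qed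
    have ?unique
    proof (rule ex_ex1I)
      let ?a = "\<lambda>j. if j = 0 then 1 / real M * (\<Sum>j<M. y (2 * j))
          else 2 / real N * (\<Sum>k<N. (-1) ^ j * y k * cos (2 * pi * real j * real k / real N))"
      have "?interp (cos_poly b M ?a)" by (subst coeff) simp
      thus "\<exists>F. (\<exists>a. F = cos_poly b M a) \<and> ?interp F"
        by (intro exI[of _ "cos_poly b M ?a"] conjI[OF exI[of _ ?a]] refl)
    next
      fix F G assume F: "(\<exists>a. F = cos_poly b M a) \<and> ?interp F"
        and G: "(\<exists>a. G = cos_poly b M a) \<and> ?interp G"
      obtain a c where a: "F = cos_poly b M a" and c: "G = cos_poly b M c" using F G by blast
      have "?coeff a" "?coeff c" using F G unfolding a c coeff by simp_all
      hence "a j = c j" if "j < M" for j using that by (cases "j = 0") auto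
      thus "F = G" by (simp add: a c cos_poly_def)
    qed
    thus ?thesis using coeff by (intro conjI allI)
  qed

  \<comment> \<open>Odd \<open>f\<close>: sine interpolation of the unshifted data\<close>
  have odd_case: "(\<exists>!F. (\<exists>a. F = sin_poly b M a) \<and> (\<forall>k<N. F (x k) = y k)) \<and>
        (\<forall>a. (\<forall>j<M. a j = 2 / real N * (\<Sum>k<N. (-1) ^ j * y k * sin (2 * pi * real j * real k / real N)))
           \<longrightarrow> (\<forall>k<N. sin_poly b M a (x k) = y k)) \<and>
        (\<forall>a. (\<forall>k<N. sin_poly b M a (x k) = y k) \<longrightarrow>
           (\<forall>j. 1 \<le> j \<and> j < M \<longrightarrow>
              a j = 2 / real N * (\<Sum>k<N. (-1) ^ j * y k * sin (2 * pi * real j * real k / real N))))"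
    (is "?unique \<and> ?sufficient \<and> ?necessary")
    if odd: "\<forall>t. f (- t) = - f t"
  proof -
    let ?A = "\<lambda>j. 2 / real N * (\<Sum>k<N. (-1) ^ j * y k * sin (2 * pi * real j * real k / real N))"
    have y_reflect: "y (N - k) = - y k" if "0 < k" "k < N" for k
      using that odd by (simp add: y x_reflect)
    \<comment> \<open>The mirror image \<open>b\<close> of the node \<open>x 0 = - b\<close> is not
      a node, so the reflection cannot reach it. Periodicity identifies the two points, and oddness
      then forces the value to be zero.\<close>
    have "f (- b) = f b" using per[rule_format, of "- b"] by simp
    hence y_0: "y 0 = 0" using odd[rule_format, of b] N0 by (simp add: y x)
    have coeff: "(\<forall>k<N. sin_poly b M a (x k) = y k) \<longleftrightarrow> (\<forall>j. 1 \<le> j \<and> j < M \<longrightarrow> a j = ?A j)" for a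
    proof -
      have "(\<forall>k<N. sin_poly b M a (x k) = y k) \<longleftrightarrow>
          (\<forall>k<N. (\<Sum>j<M. ((-1) ^ j * a j) * sin (2 * pi * real j * real k / real N)) = y k)"
        by (simp add: sin_poly_x)
      also have "\<dots> \<longleftrightarrow> (\<forall>j. 1 \<le> j \<and> j < M \<longrightarrow> (-1) ^ j * a j =
          2 / real N * (\<Sum>k<N. y k * sin (2 * pi * real j * real k / real N)))"
        using M N y_reflect y_0 by (rule dst_interpolation_iff)
      also have "\<dots> \<longleftrightarrow> (\<forall>j. 1 \<le> j \<and> j < M \<longrightarrow> a j = ?A j)"
        by (simp only: neg_one_power_mult_eq_sum_iff)
      finally show ?thesis .
    qed
    have ?unique
    proof (rule ex_ex1I)
      have "\<forall>k<N. sin_poly b M ?A (x k) = y k" by (subst coeff) simp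
      thus "\<exists>F. (\<exists>a. F = sin_poly b M a) \<and> (\<forall>k<N. F (x k) = y k)"
        by (intro exI[of _ "sin_poly b M ?A"] conjI[OF exI[of _ ?A]] refl)
    next
      fix F G assume F: "(\<exists>a. F = sin_poly b M a) \<and> (\<forall>k<N. F (x k) = y k)"
        and G: "(\<exists>a. G = sin_poly b M a) \<and> (\<forall>k<N. G (x k) = y k)"
      obtain a c where a: "F = sin_poly b M a" and c: "G = sin_poly b M c" using F G by blast
      have "\<forall>j. 1 \<le> j \<and> j < M \<longrightarrow> a j = ?A j" "\<forall>j. 1 \<le> j \<and> j < M \<longrightarrow> c j = ?A j"
        using F G unfolding a c coeff by simp_all
      \<comment> \<open>Summands are compared instead of coefficients: \<open>a 0\<close> and
        \<open>c 0\<close> may differ, but both are multiplied by \<open>sin 0\<close>.\<close>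
      hence "a j * sin (real j * pi * t / b) = c j * sin (real j * pi * t / b)" if "j < M" for j t
        using that by (cases "j = 0") auto
      thus "F = G" unfolding a c sin_poly_def by (intro ext sum.cong) auto
    qed
    moreover have ?sufficient unfolding coeff by simp
    moreover have ?necessary unfolding coeff by simp
    ultimately show ?thesis by (intro conjI)
  qed

  show ?thesis by (intro conjI impI even_case odd_case)
qed

end
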